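(* For all positive integers $r\ge2$, $t\ge2$ and $n$ there exists an $r$-uniform $r$-partite hypergraph $H$ with all parts of size $n$ and \[ \delta'_{r-1}(H)\ge\frac{n}{(r-1)t+1}-1 \] that has no $t$-shallow hitting edge set.
   Context: A hypergraph $H=(V,E)$ has a finite vertex set and a finite multiset of edges (subsets of $V$). It is $r$-uniform if each edge has $r$ vertices and $r$-partite with parts $V_1,\dots,V_r$ if these partition $V$ and every edge meets each $V_i$ in at most one vertex. A set $\hat e\subseteq V$ is legal if $|\hat e\cap V_i|\le1$ for all $i$. For $\hat e$ with $|\hat e|=r-1$, $N_{r-1}(\hat e)$ is the set of vertices $v$ with $\hat e\cup\{v\}$ an edge of $H$; $\delta'_{r-1}(H)$ is the minimum of $|N_{r-1}(\hat e)|$ over all legal $(r-1)$-sets $\hat e$. For $M\subseteq E$, $\deg_M(v)$ is the number of edges of $M$ containing $v$; $M$ is hitting if $\deg_M(v)\ge1$ for all $v$, and $t$-shallow if $\deg_M(v)\le t$ for all $v$. *)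

theory Defs
  imports Complex_Main "HOL-Library.Multiset" "HOL-Library.Disjoint_Sets"
begin

record 'a hypergraph =
  verts :: "'a set"
  edges :: "'a set multiset"

definition wf_hypergraph :: "'a hypergraph \<Rightarrow> bool" where
  "wf_hypergraph H \<longleftrightarrow> finite (verts H) \<and> (\<forall>e \<in># edges H. e \<subseteq> verts H)"

definition uniform :: "nat \<Rightarrow> 'a hypergraph \<Rightarrow> bool" where
  "uniform r H \<longleftrightarrow> (\<forall>e \<in># edges H. card e = r)"

text \<open>The parts are \<open>P 1, \<dots>, P r\<close>; values of \<open>P\<close> at other indices are irrelevant. Empty parts
  are not excluded here.\<close>

definition partite :: "nat \<Rightarrow> (nat \<Rightarrow> 'a set) \<Rightarrow> 'a hypergraph \<Rightarrow> bool" where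
  "partite r P H \<longleftrightarrow>
     (\<Union>i\<in>{1..r}. P i) = verts H \<and> disjoint_family_on P {1..r} \<and>
     (\<forall>e \<in># edges H. \<forall>i\<in>{1..r}. card (e \<inter> P i) \<le> 1)"

definition legal :: "nat \<Rightarrow> (nat \<Rightarrow> 'a set) \<Rightarrow> 'a hypergraph \<Rightarrow> 'a set \<Rightarrow> bool" where
  "legal r P H S \<longleftrightarrow> S \<subseteq> verts H \<and> (\<forall>i\<in>{1..r}. card (S \<inter> P i) \<le> 1)"

definition nbhd :: "'a hypergraph \<Rightarrow> 'a set \<Rightarrow> 'a set" where
  "nbhd H S = {v \<in> verts H. S \<union> {v} \<in># edges H}"

text \<open>\<open>\<delta>'\<^sub>r\<^sub>-\<^sub>1(H)\<close>. The minimum is over a finite nonempty set whenever \<open>r \<ge> 1\<close>, \<open>H\<close> is a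
  well-formed hypergraph that is \<open>r\<close>-partite with parts \<open>P\<close>, and all parts are nonempty.\<close>

definition min_legal_codegree :: "nat \<Rightarrow> (nat \<Rightarrow> 'a set) \<Rightarrow> 'a hypergraph \<Rightarrow> nat" where
  "min_legal_codegree r P H =
     Min ((\<lambda>S. card (nbhd H S)) ` {S. legal r P H S \<and> card S = r - 1})"

definition edge_deg :: "'a set multiset \<Rightarrow> 'a \<Rightarrow> nat" where
  "edge_deg M v = size {# e \<in># M. v \<in> e #}"

definition hitting :: "'a hypergraph \<Rightarrow> 'a set multiset \<Rightarrow> bool" where
  "hitting H M \<longleftrightarrow> (\<forall>v\<in>verts H. edge_deg M v \<ge> 1)"

definition shallow :: "nat \<Rightarrow> 'a hypergraph \<Rightarrow> 'a set multiset \<Rightarrow> bool" where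
  "shallow t H M \<longleftrightarrow> (\<forall>v\<in>verts H. edge_deg M v \<le> t)"

end

theory Submission imports Defs begin

text \<open>Choose \<open>s\<close> vertices in each part, let \<open>A\<close> be their union, and let \<open>H\<close> consist of all
  transversals of the parts that meet \<open>A\<close>. A legal \<open>(r - 1)\<close>-set misses some part, and every
  vertex of \<open>A\<close> in that part extends it to an edge, so the codegree is at least \<open>s\<close>. The edges of
  \<open>H\<close> covering the \<open>n - s\<close> vertices of \<open>P 1 - A\<close> each meet \<open>A\<close> in another part, so a
  \<open>t\<close>-shallow hitting set would give \<open>n - s \<le> t (r - 1) s\<close>. The choice of \<open>s\<close> as the largest
  integer with \<open>s ((r - 1) t + 1) < n\<close> rules this out.\<close>

text \<open>Double counting of incidences between \<open>X\<close> and \<open>M\<close>; induction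
  on \<open>M\<close> counts repeated edges with their multiplicity.\<close>

lemma sum_edge_deg:
  assumes "finite X"
  shows "(\<Sum>v\<in>X. edge_deg M v) = (\<Sum>e\<in>#M. card (e \<inter> X))"
proof (induction M)
  case empty
  show ?case by (simp add: edge_deg_def)
next
  case (add e M)
  have "(\<Sum>v\<in>X. edge_deg (add_mset e M) v) = (\<Sum>v\<in>X. (if v \<in> e then 1 else 0) + edge_deg M v)"
    by (rule sum.cong) (auto simp: edge_deg_def)
  also have "\<dots> = card (e \<inter> X) + (\<Sum>v\<in>X. edge_deg M v)"
    using assms by (simp add: sum.distrib sum.If_cases Int_def conj_commute)
  finally show ?case using add by simp
qed

text \<open>Incidences of \<open>M\<close> are compared on two vertex sets. Hitting makes those with
  \<open>P j - A\<close> at least its cardinality, shallowness makes those with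
  \<open>A - P j\<close> at most \<open>t\<close> times its cardinality, and edge by edge the first
  kind never outnumbers the second.\<close>

lemma card_le_if_shallow_hitting:
  assumes wf: "wf_hypergraph H" and part: "partite r P H" and j: "j \<in> {1..r}"
    and A: "A \<subseteq> verts H" and meet: "\<And>e. e \<in># edges H \<Longrightarrow> e \<inter> A \<noteq> {}"
    and M: "M \<subseteq># edges H" "hitting H M" "shallow t H M"
  shows "card (P j - A) \<le> t * card (A - P j)"
proof -
  have Pj: "P j \<subseteq> verts H" using part j unfolding partite_def by blast
  have fin: "finite (verts H)" using wf by (simp add: wf_hypergraph_def)
  have fP: "finite (P j - A)" and fA: "finite (A - P j)"
    using fin Pj A by (auto intro: finite_subset)
  have le: "card (e \<inter> (P j - A)) \<le> card (e \<inter> (A - P j))" if "e \<in># M" for e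
  proof (cases "e \<inter> (P j - A) = {}")
    case False
    have e: "e \<in># edges H" using that M(1) by (rule mset_subset_eqD[rotated])
    have c: "card (e \<inter> P j) \<le> 1" using part e j by (auto simp: partite_def)
    have f: "finite (e \<inter> P j)" using fin Pj by (auto intro: finite_subset)
    obtain x where x: "x \<in> e" "x \<in> P j" "x \<notin> A" using False by blast
    obtain y where y: "y \<in> e" "y \<in> A" using meet[OF e] by blast
    \<comment> \<open>The only vertex of \<open>e\<close> in \<open>P j\<close> is \<open>x\<close>,
      and \<open>y\<close> differs from \<open>x\<close> because it lies in
      \<open>A\<close>.\<close>
    have "y \<notin> P j"
      using c f x y by (metis IntI One_nat_def card_le_Suc0_iff_eq)
    hence "card (e \<inter> (A - P j)) > 0" using y fA by (auto simp: card_gt_0_iff)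
    moreover have "card (e \<inter> (P j - A)) \<le> card (e \<inter> P j)"
      using f by (intro card_mono) auto
    ultimately show ?thesis using c by linarith
  qed simp
  have "card (P j - A) = (\<Sum>v\<in>P j - A. 1)" by simp
  also have "\<dots> \<le> (\<Sum>v\<in>P j - A. edge_deg M v)"
    using M(2) Pj by (intro sum_mono) (auto simp: hitting_def)
  also have "\<dots> = (\<Sum>e\<in>#M. card (e \<inter> (P j - A)))" by (rule sum_edge_deg[OF fP])
  also have "\<dots> \<le> (\<Sum>e\<in>#M. card (e \<inter> (A - P j)))" by (rule sum_mset_mono[OF le])
  also have "\<dots> = (\<Sum>v\<in>A - P j. edge_deg M v)" by (rule sum_edge_deg[OF fA, symmetric])
  also have "\<dots> \<le> (\<Sum>v\<in>A - P j. t)"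
    using M(3) A by (intro sum_mono) (auto simp: shallow_def)
  finally show ?thesis by (simp add: mult.commute)
qed

text \<open>Meeting all \<open>r\<close> disjoint parts would require at least \<open>r\<close>
  vertices.\<close>

lemma legal_misses_part:
  assumes "finite (verts H)" and part: "partite r P H"
    and S: "legal r P H S" "card S < r"
  obtains i where "i \<in> {1..r}" "S \<inter> P i = {}"
proof (rule ccontr)
  assume "\<not> thesis"
  with that have ne: "S \<inter> P i \<noteq> {}" if "i \<in> {1..r}" for i using \<open>i \<in> {1..r}\<close> by blast
  have fS: "finite S" using S(1) assms(1) by (auto simp: legal_def intro: finite_subset)
  have "r = (\<Sum>i\<in>{1..r}. 1)" by simp
  also have "\<dots> \<le> (\<Sum>i\<in>{1..r}. card (S \<inter> P i))"
    using ne fS by (intro sum_mono) (simp add: Suc_le_eq card_gt_0_iff)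
  also have "\<dots> = card (\<Union>i\<in>{1..r}. S \<inter> P i)"
    using fS part by (intro card_UN_disjoint[symmetric])
      (auto simp: partite_def disjoint_family_on_def)
  also have "\<dots> \<le> card S" using fS by (intro card_mono) auto
  finally show False using S(2) by simp
qed

text \<open>Guarantees that the minimum defining the codegree ranges over a nonempty set. One vertex
  is chosen in each of the first \<open>k\<close> parts.\<close>

lemma legal_exists:
  assumes part: "partite r P H" and ne: "\<And>i. i \<in> {1..r} \<Longrightarrow> P i \<noteq> {}" and "k \<le> r"
  obtains S where "legal r P H S" "card S = k"
proof -
  define f where "f = (\<lambda>i. SOME x. x \<in> P i)"
  have f: "f i \<in> P i" if "i \<in> {1..r}" for i
    using ne[OF that] unfolding f_def by (rule some_in_eq[THEN iffD2])
  \<comment> \<open>A chosen vertex determines its part, which yields both the legality of the image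
    and the injectivity of \<open>f\<close>.\<close>
  have disj: "i = j" if "i \<in> {1..r}" "j \<in> {1..r}" "f i \<in> P j" for i j
    using that f part unfolding partite_def disjoint_family_on_def by blast
  have "f ` {1..k} \<inter> P j \<subseteq> {f j}" if "j \<in> {1..r}" for j
    using disj[OF _ that] assms(3) by force
  hence "card (f ` {1..k} \<inter> P j) \<le> 1" if "j \<in> {1..r}" for j
    using that card_mono[of "{f j}" "f ` {1..k} \<inter> P j"] by simp
  moreover have "f ` {1..k} \<subseteq> verts H"
  proof
    fix x assume "x \<in> f ` {1..k}"
    then obtain i where "i \<in> {1..r}" "x = f i" using assms(3) by force
    thus "x \<in> verts H" using f part unfolding partite_def by blast
  qed
  moreover have "inj_on f {1..k}"
  proof (rule inj_onI)
    fix i j assume "i \<in> {1..k}" "j \<in> {1..k}" "f i = f j"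
    thus "i = j" using assms(3) f[of j] by (intro disj) auto
  qed
  hence "card (f ` {1..k}) = k" by (simp add: card_image)
  ultimately show thesis using that[of "f ` {1..k}"] by (auto simp: legal_def)
qed

text \<open>An edge has \<open>r\<close> vertices and at most one in each of \<open>r\<close> parts,
  hence exactly one in each. Using \<open>mset_set\<close> gives every edge multiplicity
  one.\<close>

definition meeting_transversals :: "nat \<Rightarrow> (nat \<Rightarrow> 'a set) \<Rightarrow> 'a set \<Rightarrow> 'a hypergraph" where
  "meeting_transversals r P A =
     \<lparr>verts = (\<Union>i\<in>{1..r}. P i),
      edges = mset_set {e. e \<subseteq> (\<Union>i\<in>{1..r}. P i) \<and> card e = r \<and>
        (\<forall>i\<in>{1..r}. card (e \<inter> P i) \<le> 1) \<and> e \<inter> A \<noteq> {}}\<rparr>"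

context
  fixes r :: nat and P :: "nat \<Rightarrow> 'a set" and A :: "'a set"
  assumes fin: "\<And>i. i \<in> {1..r} \<Longrightarrow> finite (P i)" and disj: "disjoint_family_on P {1..r}"
begin

lemma verts_meeting_transversals: "verts (meeting_transversals r P A) = (\<Union>i\<in>{1..r}. P i)"
  by (simp add: meeting_transversals_def)

lemma finite_verts_meeting_transversals: "finite (verts (meeting_transversals r P A))"
  using fin by (simp add: verts_meeting_transversals)

text \<open>Finiteness of the parts matters here: \<open>mset_set\<close> of an infinite set is the
  empty multiset.\<close>

lemma edge_meeting_transversals_iff:
  "e \<in># edges (meeting_transversals r P A) \<longleftrightarrow>
     e \<subseteq> (\<Union>i\<in>{1..r}. P i) \<and> card e = r \<and> (\<forall>i\<in>{1..r}. card (e \<inter> P i) \<le> 1) \<and> e \<inter> A \<noteq> {}"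
proof -
  have "finite {e. e \<subseteq> (\<Union>i\<in>{1..r}. P i) \<and> card e = r \<and>
      (\<forall>i\<in>{1..r}. card (e \<inter> P i) \<le> 1) \<and> e \<inter> A \<noteq> {}}"
    by (rule finite_subset[of _ "Pow (\<Union>i\<in>{1..r}. P i)"]) (use fin in auto)
  thus ?thesis by (simp add: meeting_transversals_def)
qed

lemma wf_meeting_transversals: "wf_hypergraph (meeting_transversals r P A)"
  using finite_verts_meeting_transversals
  by (simp add: wf_hypergraph_def edge_meeting_transversals_iff verts_meeting_transversals)

lemma uniform_meeting_transversals: "uniform r (meeting_transversals r P A)"
  by (simp add: uniform_def edge_meeting_transversals_iff)

lemma partite_meeting_transversals: "partite r P (meeting_transversals r P A)"
  using disj
  by (simp add: partite_def edge_meeting_transversals_iff verts_meeting_transversals)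

lemma min_legal_codegree_meeting_transversals_ge:
  assumes "r \<ge> 1" and ne: "\<And>i. i \<in> {1..r} \<Longrightarrow> P i \<noteq> {}"
    and s: "\<And>i. i \<in> {1..r} \<Longrightarrow> s \<le> card (A \<inter> P i)"
  shows "s \<le> min_legal_codegree r P (meeting_transversals r P A)"
proof -
  let ?H = "meeting_transversals r P A"
  let ?L = "{S. legal r P ?H S \<and> card S = r - 1}"
  note finV = finite_verts_meeting_transversals
  have "?L \<subseteq> Pow (verts ?H)" by (auto simp: legal_def)
  hence finL: "finite ?L" using finV by (meson finite_Pow_iff finite_subset)
  \<comment> \<open>\<open>Min\<close> has no specified value on the empty set.\<close>
  have neL: "?L \<noteq> {}"
    using legal_exists[OF partite_meeting_transversals ne, of "r - 1"] by fastforce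
  have "s \<le> card (nbhd ?H S)" if L: "legal r P ?H S" and c: "card S = r - 1" for S
  proof -
    obtain i where i: "i \<in> {1..r}" and Si: "S \<inter> P i = {}"
      using legal_misses_part[OF finV partite_meeting_transversals L] c assms(1) by auto
    have fS: "finite S" using L finV by (auto simp: legal_def intro: finite_subset)
    have "A \<inter> P i \<subseteq> nbhd ?H S"
    proof
      fix v assume v: "v \<in> A \<inter> P i"
      hence "v \<notin> S" using Si by blast
      hence "card (S \<union> {v}) = r" using fS c assms(1) by simp
      \<comment> \<open>In the missed part \<open>P i\<close> the only vertex is \<open>v\<close>;
        every other part meets the set just as it meets \<open>S\<close>.\<close>
      moreover have "card ((S \<union> {v}) \<inter> P j) \<le> 1" if j: "j \<in> {1..r}" for j
      proof (cases "j = i")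
        case True
        thus ?thesis using Si v by (simp add: Int_insert_left)
      next
        case False
        hence "v \<notin> P j" using v disj i j unfolding disjoint_family_on_def by blast
        thus ?thesis using L j by (simp add: legal_def)
      qed
      moreover have "v \<in> verts ?H" using v i by (auto simp: verts_meeting_transversals)
      ultimately show "v \<in> nbhd ?H S"
        using v L by (auto simp: nbhd_def edge_meeting_transversals_iff legal_def
            verts_meeting_transversals)
    qed
    moreover have "finite (nbhd ?H S)" using finV by (simp add: nbhd_def)
    ultimately show ?thesis using s[OF i] card_mono order_trans by blast
  qed
  thus ?thesis
    unfolding min_legal_codegree_def using finL neL by (subst Min_ge_iff) auto
qed

end

theorem theorem4p7:
  fixes r t n :: nat
  assumes "r \<ge> 2" and "t \<ge> 2" and "n \<ge> 1"
  shows "\<exists>(H :: nat hypergraph) P.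
    wf_hypergraph H \<and> uniform r H \<and> partite r P H \<and>
    (\<forall>i\<in>{1..r}. card (P i) = n) \<and>
    real (min_legal_codegree r P H) \<ge> real n / ((real r - 1) * real t + 1) - 1 \<and>
    \<not> (\<exists>M. M \<subseteq># edges H \<and> hitting H M \<and> shallow t H M)"
proof -
  \<comment> \<open>With \<open>s\<close> vertices of \<open>A\<close> in each part, a
    \<open>t\<close>-shallow hitting set accounts for at most \<open>(r - 1) * t * s\<close>
    vertices of \<open>P 1 - A\<close>; adding the \<open>s\<close> vertices of \<open>P 1\<close>
    in \<open>A\<close> gives \<open>s * k\<close>.\<close>
  define k where "k = (r - 1) * t + 1"
  \<comment> \<open>Dividing \<open>n - 1\<close> rather than \<open>n\<close> keeps
    \<open>s * k < n\<close> strict even when \<open>k\<close> divides \<open>n\<close>. If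
    \<open>s = 0\<close>, then \<open>A\<close> is empty and \<open>H\<close> has no edges.\<close>
  define s where "s = (n - 1) div k"
  \<comment> \<open>Consecutive blocks of length \<open>n\<close>, so that \<open>x div n\<close>
    recovers the part of \<open>x\<close>; \<open>B i\<close> below is an initial segment of block
    \<open>i\<close>.\<close>
  define P where "P = (\<lambda>i. {i * n..<i * n + n})"
  define B where "B = (\<lambda>i. {i * n..<i * n + s})"
  define A where "A = (\<Union>i\<in>{1..r}. B i)"
  define H where "H = meeting_transversals r P A"
  have "s * k \<le> n - 1" by (simp add: s_def)
  hence sk: "s * k < n" using assms(3) by linarith
  \<comment> \<open>Maximality of \<open>s\<close>, the source of the codegree bound.\<close>
  have "n - 1 < (s + 1) * k"
    using dividend_less_div_times[of k "n - 1"] by (simp add: s_def k_def)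
  hence "n \<le> (s + 1) * k" by linarith
  hence "real n \<le> (real s + 1) * real k" by (metis of_nat_1 of_nat_add of_nat_le_iff of_nat_mult)
  moreover have "0 < real k" unfolding of_nat_0_less_iff by (simp add: k_def)
  ultimately have "real n / real k \<le> real s + 1" by (simp only: pos_divide_le_eq)
  moreover have "real k = (real r - 1) * real t + 1" using assms(1) by (simp add: k_def of_nat_diff)
  ultimately have s_ge: "real n / ((real r - 1) * real t + 1) - 1 \<le> real s" by simp
  \<comment> \<open>Since \<open>k\<close> is positive, \<open>s < n\<close> follows, so each
    \<open>B i\<close> fits into its block.\<close>
  have "s \<le> s * k" by (simp add: k_def)
  hence sn: "s < n" using sk by linarith
  have P_div: "x \<in> P i \<longleftrightarrow> x div n = i" for x i
  proof -
    have "x div n = i \<longleftrightarrow> i * n \<le> x \<and> x < i * n + n"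
      using assms(3) by (metis One_nat_def Suc_le_eq add.commute div_nat_eqI dividend_less_times_div
          mult.commute mult_Suc_right times_div_less_eq_dividend)
    thus ?thesis by (simp add: P_def)
  qed
  have BP: "B i \<subseteq> P i" for i using sn by (auto simp: B_def P_def)
  have fin: "finite (P i)" and cP: "card (P i) = n" for i by (auto simp: P_def)
  have disj: "disjoint_family_on P {1..r}"
    by (auto simp: disjoint_family_on_def P_div)
  have AP: "A \<inter> P i = B i" if "i \<in> {1..r}" for i
  proof
    show "A \<inter> P i \<subseteq> B i"
    proof
      fix x assume x: "x \<in> A \<inter> P i"
      then obtain j where "x \<in> B j" by (auto simp: A_def)
      thus "x \<in> B i" using x BP[of j] by (auto simp: P_div)
    qed
  qed (use that BP in \<open>auto simp: A_def\<close>)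
  have cB: "card (B i) = s" for i by (simp add: B_def)
  have "P i \<noteq> {}" for i using cP[of i] assms(3) by auto
  hence "s \<le> min_legal_codegree r P H" unfolding H_def
    using assms(1) by (intro min_legal_codegree_meeting_transversals_ge fin disj) (auto simp: AP cB)
  hence codegree: "real n / ((real r - 1) * real t + 1) - 1 \<le> real (min_legal_codegree r P H)"
    using s_ge by linarith
  have one: "1 \<in> {1..r}" using assms(1) by simp
  have "P 1 - A = P 1 - B 1" using AP[OF one] by blast
  hence cPA: "card (P 1 - A) = n - s"
    using card_Diff_subset[of "B 1" "P 1"] BP[of 1] fin[of 1] cP cB by (simp add: B_def)
  \<comment> \<open>Only the other \<open>r - 1\<close> parts contribute, whence the factor
    \<open>r - 1\<close>.\<close>
  have "A - P 1 \<subseteq> (\<Union>i\<in>{2..r}. B i)"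
  proof
    fix x assume x: "x \<in> A - P 1"
    then obtain i where i: "i \<in> {1..r}" "x \<in> B i" by (auto simp: A_def)
    moreover from this have "i \<noteq> 1" using x BP[of 1] by auto
    ultimately show "x \<in> (\<Union>i\<in>{2..r}. B i)" by force
  qed
  hence "card (A - P 1) \<le> card (\<Union>i\<in>{2..r}. B i)" by (intro card_mono) (auto simp: B_def)
  also have "\<dots> \<le> (\<Sum>i\<in>{2..r}. card (B i))" by (rule card_UN_le) simp
  also have "\<dots> = (r - 1) * s" by (simp add: cB)
  finally have cAP: "t * card (A - P 1) \<le> t * ((r - 1) * s)" by simp
  have nohit: False if M: "M \<subseteq># edges H" "hitting H M" "shallow t H M" for M
  proof -
    have "card (P 1 - A) \<le> t * card (A - P 1)"
    proof (rule card_le_if_shallow_hitting[OF _ _ one _ _ M])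
      show "wf_hypergraph H" "partite r P H" unfolding H_def
        by (intro wf_meeting_transversals partite_meeting_transversals fin disj)+
      show "A \<subseteq> verts H"
        using BP by (auto simp: H_def meeting_transversals_def A_def)
      show "e \<inter> A \<noteq> {}" if "e \<in># edges H" for e
        using that unfolding H_def by (simp add: edge_meeting_transversals_iff[OF fin disj])
    qed
    with cPA cAP have "n - s \<le> t * ((r - 1) * s)" by linarith
    \<comment> \<open>Moving \<open>s\<close> to the right completes \<open>(r - 1) * t * s\<close>
      to \<open>s * k\<close>.\<close>
    hence "n \<le> s * k" by (simp add: k_def algebra_simps)
    thus False using sk by simp
  qed
  show ?thesis
  proof (intro exI conjI)
    show "wf_hypergraph H" "uniform r H" "partite r P H" unfolding H_def
      by (intro wf_meeting_transversals uniform_meeting_transversals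
          partite_meeting_transversals fin disj)+
  qed (use codegree nohit cP in auto)
qed

end
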